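(* Let $\mathbf{x}^\ast$ be an optimal solution of the convex program described in the context. If $\alpha\ge\frac12\beta^2$ in the algorithm described in the context, then for all integers $t\ge1$, $$f(\overline{\mathbf{x}}(t))\le f(\mathbf{x}^\ast)+\frac{\alpha}{t}\Vert\mathbf{x}^\ast-\mathbf{x}(-1)\Vert^2.$$
   Context: $\Vert\cdot\Vert$ is the Euclidean norm. Fix positive integers $n,m$. Let $\mathcal{X}\subseteq\mathbb{R}^n$ be a closed convex set, $f:\mathcal{X}\to\mathbb{R}$ continuous and convex, and $g_1,\ldots,g_m:\mathcal{X}\to\mathbb{R}$ convex and Lipschitz continuous (no differentiability assumed). Write $\mathbf{g}(\mathbf{x})=[g_1(\mathbf{x}),\ldots,g_m(\mathbf{x})]^T$. The convex program is: minimize $f(\mathbf{x})$ subject to $g_k(\mathbf{x})\le 0$ for all $k\in\{1,\ldots,m\}$ and $\mathbf{x}\in\mathcal{X}$. Standing assumptions: (1) the convex program has a (possibly non-unique) optimal solution $\mathbf{x}^\ast\in\mathcal{X}$, and $\beta$ is a constant with $\Vert\mathbf{g}(\mathbf{x}_1)-\mathbf{g}(\mathbf{x}_2)\Vert\le\beta\Vert\mathbf{x}_1-\mathbf{x}_2\Vert$ for all $\mathbf{x}_1,\mathbf{x}_2\in\mathcal{X}$; (2) there is a Lagrange multiplier vector $\boldsymbol{\lambda}^\ast=[\lambda_1^\ast,\ldots,\lambda_m^\ast]^T\ge\mathbf{0}$ attaining strong duality, i.e. $q(\boldsymbol{\lambda}^\ast)=\min_{\mathbf{x}\in\mathcal{X}}\{f(\mathbf{x}):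 g_k(\mathbf{x})\le 0,\ \forall k\}$, where $q(\boldsymbol{\lambda})=\min_{\mathbf{x}\in\mathcal{X}}\{f(\mathbf{x})+\sum_{k=1}^m\lambda_k g_k(\mathbf{x})\}$. Algorithm: let $\alpha>0$ be a constant, choose any $\mathbf{x}(-1)\in\mathcal{X}$, and set $Q_k(0)=\max\{0,-g_k(\mathbf{x}(-1))\}$ for all $k$. With $\mathbf{Q}(t)=[Q_1(t),\ldots,Q_m(t)]^T$, at each iteration $t\in\{0,1,2,\ldots\}$ set $$\mathbf{x}(t)=\mathop{\mathrm{argmin}}_{\mathbf{x}\in\mathcal{X}}\Big\{f(\mathbf{x})+[\mathbf{Q}(t)+\mathbf{g}(\mathbf{x}(t-1))]^T\mathbf{g}(\mathbf{x})+\alpha\Vert\mathbf{x}-\mathbf{x}(t-1)\Vert^2\Big\},$$ $$Q_k(t+1)=\max\{-g_k(\mathbf{x}(t)),\,Q_k(t)+g_k(\mathbf{x}(t))\},\quad \forall k\in\{1,\ldots,m\}.$$ For $t\ge1$ define $\overline{\mathbf{x}}(t)=\frac1t\sum_{\tau=0}^{t-1}\mathbf{x}(\tau)$. *)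

theory Defs
  imports "HOL-Analysis.Analysis"
begin

definition feasible_set ::
  "(real ^ 'n) set \<Rightarrow> (real ^ 'n \<Rightarrow> real ^ 'm) \<Rightarrow> (real ^ 'n) set" where
  "feasible_set X g = {x \<in> X. \<forall>k. g x $ k \<le> 0}"

definition optimal_solution ::
  "(real ^ 'n) set \<Rightarrow> (real ^ 'n \<Rightarrow> real) \<Rightarrow> (real ^ 'n \<Rightarrow> real ^ 'm) \<Rightarrow> real ^ 'n \<Rightarrow> bool" where
  "optimal_solution X f g x \<longleftrightarrow> is_arg_min f (\<lambda>y. y \<in> feasible_set X g) x"

text \<open>
  The minima defining the dual function and the optimal value are written as infima in the
  extended reals, because the Lagrangian need not be bounded below for an arbitrary multiplier.
  If an optimal solution \<open>x\<close> exists and a multiplier attains strong duality, both infima are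
  attained at \<open>x\<close>, so they are minima there.
\<close>

definition dual_function ::
  "(real ^ 'n) set \<Rightarrow> (real ^ 'n \<Rightarrow> real) \<Rightarrow> (real ^ 'n \<Rightarrow> real ^ 'm) \<Rightarrow> real ^ 'm \<Rightarrow> ereal" where
  "dual_function X f g l = (INF x\<in>X. ereal (f x + (\<Sum>k\<in>UNIV. l $ k * g x $ k)))"

definition optimal_value ::
  "(real ^ 'n) set \<Rightarrow> (real ^ 'n \<Rightarrow> real) \<Rightarrow> (real ^ 'n \<Rightarrow> real ^ 'm) \<Rightarrow> ereal" where
  "optimal_value X f g = (INF x\<in>feasible_set X g. ereal (f x))"

definition attains_strong_duality ::
  "(real ^ 'n) set \<Rightarrow> (real ^ 'n \<Rightarrow> real) \<Rightarrow> (real ^ 'n \<Rightarrow> real ^ 'm) \<Rightarrow> real ^ 'm \<Rightarrow> bool" where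
  "attains_strong_duality X f g l \<longleftrightarrow>
     (\<forall>k. 0 \<le> l $ k) \<and> dual_function X f g l = optimal_value X f g"

text \<open>
  The primal iterates are indexed by integers so that the initial point is \<open>x (-1)\<close>; values at
  indices below \<open>-1\<close> play no role. Along a run \<open>Q t + g (x (int t - 1))\<close> is
  componentwise nonnegative, so for convex data and \<open>\<alpha> > 0\<close> the objective of each step is
  strongly convex and its minimiser is unique.
\<close>

definition algorithm_run ::
  "(real ^ 'n) set \<Rightarrow> (real ^ 'n \<Rightarrow> real) \<Rightarrow> (real ^ 'n \<Rightarrow> real ^ 'm) \<Rightarrow> real \<Rightarrow>
   (int \<Rightarrow> real ^ 'n) \<Rightarrow> (nat \<Rightarrow> real ^ 'm) \<Rightarrow> bool" where
  "algorithm_run X f g \<alpha> x Q \<longleftrightarrow>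
     x (-1) \<in> X \<and>
     (\<forall>k. Q 0 $ k = max 0 (- (g (x (-1)) $ k))) \<and>
     (\<forall>t::nat. is_arg_min
        (\<lambda>y. f y + (Q t + g (x (int t - 1))) \<bullet> g y + \<alpha> * (norm (y - x (int t - 1)))\<^sup>2)
        (\<lambda>y. y \<in> X) (x (int t))) \<and>
     (\<forall>(t::nat) k. Q (Suc t) $ k = max (- (g (x (int t)) $ k)) (Q t $ k + g (x (int t)) $ k))"

definition running_average :: "(int \<Rightarrow> real ^ 'n) \<Rightarrow> nat \<Rightarrow> real ^ 'n" where
  "running_average x t = (1 / real t) *\<^sub>R (\<Sum>\<tau><t. x (int \<tau>))"

end

(*
  The step objective is 2\<alpha>-strongly convex, so its minimiser x(t) satisfies the three-point
  inequality against x_opt.  The weights Q(t) + g(x(t-1)) are nonnegative and g(x_opt) \<le> 0, so the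
  constraint term at x_opt can be dropped.  Combining this with the drift bound
  |Q(t+1)|^2 - |Q(t)|^2 \<le> 2 Q(t).g(x(t)) + 2 |g(x(t))|^2 and polarising g(x(t-1)).g(x(t)) leaves
  |g(x(t)) - g(x(t-1))|^2 / 2, which the proximal term absorbs when \<alpha> \<ge> \<beta>^2 / 2.  Hence
  f(x(t)) - f(x_opt) is at most the decrease of the potential
  \<alpha> |x_opt - x(t)|^2 + (|Q(t+1)|^2 - |g(x(t))|^2) / 2, which is nonnegative because
  Q_k(t+1) \<ge> |g_k(x(t))|.  Telescoping and Jensen's inequality finish the proof.
*)
theory Submission
  imports Defs
begin

text \<open>Minimality is tested at points of the segment from \<open>y\<close> to \<open>z\<close>,
  where the squared distance to \<open>p\<close> falls short of linear interpolation by
  \<open>s * (1 - s) * (norm (z - y))\<^sup>2\<close>. Dividing by \<open>s\<close> and letting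
  \<open>s\<close> tend to 0 recovers the full extra term.\<close>

lemma prox_three_point:
  fixes h :: "'a::real_inner \<Rightarrow> real"
  assumes conv: "convex_on X h"
    and min: "is_arg_min (\<lambda>y. h y + \<alpha> * (norm (y - p))\<^sup>2) (\<lambda>y. y \<in> X) y"
    and z: "z \<in> X"
  shows "h y + \<alpha> * (norm (y - p))\<^sup>2 + \<alpha> * (norm (z - y))\<^sup>2 \<le> h z + \<alpha> * (norm (z - p))\<^sup>2"
proof -
  let ?F = "\<lambda>y. h y + \<alpha> * (norm (y - p))\<^sup>2"
  let ?D = "\<alpha> * (norm (z - y))\<^sup>2"
  have y: "y \<in> X" and le: "?F y \<le> ?F u" if "u \<in> X" for u
    using min z that by (auto simp: is_arg_min_linorder)
  have bound: "?F y - ?F z + (1 - s) * ?D \<le> 0" if s: "0 < s" "s < 1" for s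
  proof -
    let ?u = "(1 - s) *\<^sub>R y + s *\<^sub>R z"
    have "?u \<in> X"
      using convex_on_imp_convex[OF conv] y[OF z] z s by (simp add: convex_alt)
    then have "?F y \<le> ?F ?u" by (rule le)
    also have "h ?u \<le> (1 - s) * h y + s * h z"
      using convex_onD[OF conv, of s y z] y[OF z] z s by simp
    also have "(norm (?u - p))\<^sup>2
        = (1 - s) * (norm (y - p))\<^sup>2 + s * (norm (z - p))\<^sup>2 - s * (1 - s) * (norm (z - y))\<^sup>2"
      by (simp add: power2_norm_eq_inner inner_simps inner_commute algebra_simps)
    finally have "s * (?F y - ?F z + (1 - s) * ?D) \<le> 0"
      by (simp add: algebra_simps)
    then show ?thesis
      using s by (simp add: mult_le_0_iff)
  qed
  \<comment> \<open>\<open>bound\<close> excludes \<open>s = 0\<close> because of the division by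
    \<open>s\<close>, so this value is reached as a one-sided limit.\<close>
  have "((\<lambda>s. ?F y - ?F z + (1 - s) * ?D) \<longlongrightarrow> ?F y - ?F z + (1 - 0) * ?D) (at_right 0)"
    by (intro tendsto_intros)
  moreover have "\<forall>\<^sub>F s in at_right (0::real). ?F y - ?F z + (1 - s) * ?D \<le> 0"
    unfolding eventually_at_right_field using bound by (intro exI[of _ 1]) auto
  ultimately have "?F y - ?F z + (1 - 0) * ?D \<le> 0"
    by (rule tendsto_upperbound) simp
  then show ?thesis by simp
qed

lemma convex_on_inner_nonneg:
  fixes g :: "'a::real_vector \<Rightarrow> real ^ 'm"
  assumes "convex X" and "\<And>k. convex_on X (\<lambda>y. g y $ k)" and "\<And>k. 0 \<le> w $ k"
  shows "convex_on X (\<lambda>y. w \<bullet> g y)"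
proof -
  have "convex_on X (\<lambda>y. \<Sum>k\<in>S. w $ k * g y $ k)" if "finite S" for S
    using that
  proof induction
    case empty
    then show ?case using assms(1) by (simp add: convex_on_const)
  next
    case (insert k S)
    then show ?case
      using assms by (auto intro!: convex_on_add convex_on_cmul)
  qed
  then show ?thesis by (simp add: inner_vec_def)
qed

text \<open>Works componentwise. If the maximum is \<open>q + c\<close>, the squares differ by
  exactly \<open>2qc + c^2\<close>; if it is \<open>-c\<close>, the claimed bound rearranges to
  \<open>(q + c)^2 \<ge> 0\<close>.\<close>

lemma queue_drift:
  fixes q q' c :: "real ^ 'm"
  assumes "\<And>k. q' $ k = max (- (c $ k)) (q $ k + c $ k)"
  shows "(norm q')\<^sup>2 - (norm q)\<^sup>2 \<le> 2 * (q \<bullet> c) + 2 * (norm c)\<^sup>2"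
proof -
  have "(q' $ k)\<^sup>2 - (q $ k)\<^sup>2 \<le> 2 * (q $ k * c $ k) + 2 * (c $ k)\<^sup>2" for k
  proof (cases "- (c $ k) \<le> q $ k + c $ k")
    case True
    then show ?thesis using assms[of k] by (simp add: power2_eq_square algebra_simps)
  next
    case False
    moreover have "0 \<le> (q $ k + c $ k)\<^sup>2" by simp
    ultimately show ?thesis
      using assms[of k] by (simp add: power2_eq_square algebra_simps)
  qed
  then have "(\<Sum>k\<in>UNIV. (q' $ k)\<^sup>2 - (q $ k)\<^sup>2)
      \<le> (\<Sum>k\<in>UNIV. 2 * (q $ k * c $ k) + 2 * (c $ k)\<^sup>2)"
    by (intro sum_mono)
  then show ?thesis
    unfolding power2_norm_eq_inner
    by (simp add: inner_vec_def sum_subtractf sum.distrib sum_distrib_left power2_eq_square)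
qed

lemma power2_norm_vec_le:
  fixes u v :: "real ^ 'm"
  assumes "\<And>k. \<bar>u $ k\<bar> \<le> \<bar>v $ k\<bar>"
  shows "(norm u)\<^sup>2 \<le> (norm v)\<^sup>2"
  using norm_le_componentwise_cart[of u v] assms by (simp add: power_mono)

lemma running_average_convex:
  assumes "convex_on X f" and "\<And>\<tau>. x (int \<tau>) \<in> X" and "t \<ge> 1"
  shows "f (running_average x t) \<le> (\<Sum>\<tau><t. f (x (int \<tau>))) / real t"
proof -
  have "f (\<Sum>\<tau><t. (1 / real t) *\<^sub>R x (int \<tau>)) \<le> (\<Sum>\<tau><t. (1 / real t) * f (x (int \<tau>)))"
    by (rule convex_on_sum) (use assms in \<open>auto simp: lessThan_empty_iff\<close>)
  then show ?thesis
    by (simp add: running_average_def scaleR_sum_right sum_divide_distrib)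
qed

theorem theorem1:
  fixes X :: "(real ^ 'n) set"
    and f :: "real ^ 'n \<Rightarrow> real"
    and g :: "real ^ 'n \<Rightarrow> real ^ 'm"
    and \<alpha> \<beta> :: real
    and x :: "int \<Rightarrow> real ^ 'n"
    and Q :: "nat \<Rightarrow> real ^ 'm"
    and x_opt :: "real ^ 'n"
  assumes "closed X" and "convex X"
    and "continuous_on X f" and "convex_on X f"
    and "\<forall>k. convex_on X (\<lambda>y. g y $ k)"
    and "\<forall>k. \<exists>L. L-lipschitz_on X (\<lambda>y. g y $ k)"
    and "optimal_solution X f g x_opt"
    and "\<forall>x1\<in>X. \<forall>x2\<in>X. norm (g x1 - g x2) \<le> \<beta> * norm (x1 - x2)"
    and "\<exists>l. attains_strong_duality X f g l"
    and "\<alpha> > 0"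
    and "algorithm_run X f g \<alpha> x Q"
    and "\<alpha> \<ge> 1 / 2 * \<beta>\<^sup>2"
  shows "\<forall>t::nat. t \<ge> 1 \<longrightarrow>
    f (running_average x t) \<le> f x_opt + \<alpha> / real t * (norm (x_opt - x (-1)))\<^sup>2"
proof (intro allI impI)
  fix t :: nat assume t: "t \<ge> 1"
  define z where "z = x_opt"
  \<comment> \<open>The shift by one starts the iterates at \<open>y 0\<close>, the initial point,
    and pairs \<open>Q s\<close> with \<open>y s\<close>.\<close>
  define y where "y s = x (int s - 1)" for s :: nat
  have yS: "x (int s) = y (Suc s)" for s
    by (simp add: y_def)
  have z: "z \<in> X" "\<And>k. g z $ k \<le> 0"
    using assms(7) by (auto simp: z_def optimal_solution_def feasible_set_def is_arg_min_def)
  have y0: "y 0 \<in> X" "\<And>k. Q 0 $ k = max 0 (- (g (y 0) $ k))"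
    using assms(11) by (auto simp: y_def algorithm_run_def)
  have step: "is_arg_min
        (\<lambda>u. f u + (Q s + g (y s)) \<bullet> g u + \<alpha> * (norm (u - y s))\<^sup>2) (\<lambda>u. u \<in> X) (y (Suc s))"
    and Q: "\<And>k. Q (Suc s) $ k = max (- (g (y (Suc s)) $ k)) (Q s $ k + g (y (Suc s)) $ k)" for s
    using assms(11) unfolding algorithm_run_def by (auto simp: y_def)
  have yX: "y s \<in> X" for s
    using y0(1) step by (cases s) (auto simp: is_arg_min_def)
  \<comment> \<open>Both the initialisation and the update keep \<open>Q s $ k\<close> at least
    \<open>- g (y s) $ k\<close>.\<close>
  have w: "0 \<le> Q s $ k + g (y s) $ k" for s k
    using y0(2)[of k] Q[of _ k] by (cases s) auto
  have Q_nonneg: "0 \<le> Q s $ k" for s k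
    using y0(2)[of k] Q[of _ k] by (induction s) (auto simp: max_def)
  define V where "V s = \<alpha> * (norm (z - y s))\<^sup>2 + ((norm (Q s))\<^sup>2 - (norm (g (y s)))\<^sup>2) / 2" for s
  have dec: "f (y (Suc s)) \<le> f z + V s - V (Suc s)" for s
  proof -
    let ?w = "Q s + g (y s)" and ?p = "y s" and ?u = "y (Suc s)"
    have conv: "convex_on X (\<lambda>u. f u + ?w \<bullet> g u)"
      using assms w by (intro convex_on_add convex_on_inner_nonneg) auto
    have prox: "f ?u + ?w \<bullet> g ?u + \<alpha> * (norm (?u - ?p))\<^sup>2 + \<alpha> * (norm (z - ?u))\<^sup>2
        \<le> f z + ?w \<bullet> g z + \<alpha> * (norm (z - ?p))\<^sup>2"
      by (rule prox_three_point[OF conv step z(1)])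
    have "?w \<bullet> g z \<le> 0"
      unfolding inner_vec_def using w z(2) by (intro sum_nonpos) (auto simp: mult_nonneg_nonpos)
    moreover have "(norm (Q (Suc s)))\<^sup>2 - (norm (Q s))\<^sup>2 \<le> 2 * (Q s \<bullet> g ?u) + 2 * (norm (g ?u))\<^sup>2"
      by (rule queue_drift[OF Q])
    moreover have "(norm (g ?u - g ?p))\<^sup>2 / 2 \<le> \<alpha> * (norm (?u - ?p))\<^sup>2"
    proof -
      have "(norm (g ?u - g ?p))\<^sup>2 \<le> (\<beta> * norm (?u - ?p))\<^sup>2"
        using assms(8) yX by (intro power_mono) auto
      also have "\<dots> \<le> (2 * \<alpha>) * (norm (?u - ?p))\<^sup>2"
        unfolding power_mult_distrib using assms(12) by (intro mult_right_mono) auto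
      finally show ?thesis by simp
    qed
    moreover have "(norm (g ?u - g ?p))\<^sup>2
        = (norm (g ?u))\<^sup>2 + (norm (g ?p))\<^sup>2 - 2 * (g ?p \<bullet> g ?u)"
      by (simp add: power2_norm_eq_inner inner_diff inner_commute)
    \<comment> \<open>Half the drift bound costs \<open>|g ?u|^2\<close>, and polarisation returns
      half of it together with \<open>|g ?p|^2 / 2\<close>; what is left are the two
      \<open>g\<close> terms in \<open>V\<close>.\<close>
    ultimately show ?thesis
      using prox unfolding V_def inner_add_left by argo
  qed
  \<comment> \<open>The initial queue is the negative part of \<open>g (y 0)\<close>, so the second
    term of \<open>V 0\<close> is at most 0.\<close>
  have V0: "V 0 \<le> \<alpha> * (norm (z - y 0))\<^sup>2"
    using power2_norm_vec_le[of "Q 0" "g (y 0)"] y0(2) by (simp add: V_def)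
  have Vt: "0 \<le> V t"
  proof -
    \<comment> \<open>Only after an update does the queue dominate \<open>g\<close>:
      \<open>Q t $ k\<close> is at least \<open>- g (y t) $ k\<close> and, as the previous queue is
      nonnegative, at least \<open>g (y t) $ k\<close>. At index 0 the comparison goes the other
      way.\<close>
    obtain s where s: "t = Suc s" using t by (cases t) auto
    have "\<bar>g (y t) $ k\<bar> \<le> \<bar>Q t $ k\<bar>" for k
      using Q[of s k] Q_nonneg[of s k] unfolding s by auto
    from power2_norm_vec_le[OF this] show ?thesis
      using assms(10) by (simp add: V_def)
  qed
  have "(\<Sum>\<tau><t. f (y (Suc \<tau>))) \<le> (\<Sum>\<tau><t. f z + (V \<tau> - V (Suc \<tau>)))"
    using dec by (intro sum_mono) (simp add: algebra_simps)
  also have "\<dots> = real t * f z + (V 0 - V t)"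
    by (simp add: sum.distrib sum_lessThan_telescope')
  also have "\<dots> \<le> real t * f z + \<alpha> * (norm (z - y 0))\<^sup>2"
    using V0 Vt by simp
  finally have "(\<Sum>\<tau><t. f (y (Suc \<tau>))) / real t \<le> f z + \<alpha> / real t * (norm (z - y 0))\<^sup>2"
    using t by (simp add: field_simps)
  moreover have "f (running_average x t) \<le> (\<Sum>\<tau><t. f (x (int \<tau>))) / real t"
    using assms(4) yX t by (intro running_average_convex) (auto simp: yS)
  ultimately show "f (running_average x t) \<le> f x_opt + \<alpha> / real t * (norm (x_opt - x (-1)))\<^sup>2"
    by (simp add: yS z_def) (simp add: y_def)
qed

end
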